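(* Let $A$ be an integral Poisson algebra over $\Bbbk$ and write $\Lambda=\Lambda(A)$. Then the following are equivalent: (i) $[\Lambda,\Lambda]=0$, i.e. $[\lambda,\mu]=\lambda\circ\mu-\mu\circ\lambda=0$ for all $\lambda,\mu\in\Lambda$; (ii) $A^{\mathrm{sc}}$ is a Poisson subalgebra of $A$ and the direct sum decomposition $A^{\mathrm{sc}}=\bigoplus_{\lambda\in\Lambda}A_\lambda$ into weight spaces is a Poisson grading, i.e. $\{A_\lambda,A_\mu\}\subseteq A_{\lambda+\mu}$ for all $\lambda,\mu\in\Lambda$. If (i) or (ii) holds then $A$ is said to have the abelian weight property. Furthermore, in that case, $\lambda(A_\mu)\subseteq A_\mu$ for all $\lambda,\mu\in\Lambda$.
   Context: $\Bbbk$ is a field of characteristic zero. A Poisson algebra over $\Bbbk$ is a commutative associative unital $\Bbbk$-algebra with a $\Bbbk$-bilinear Lie bracket $\{\cdot,\cdot\}$ that is a derivation in each argument. It is integral if it is an integral domain. An element $a\in A$ is Poisson normal if $\{A,a\}\subseteq Aa$. The Poisson semi-centre $A^{\mathrm{sc}}$ is the $\Bbbk$-subalgebra of $A$ generated by the Poisson normal elements of $A$. A Poisson derivation of $A$ is a $\Bbbk$-linear map $\lambda:A\to A$ that is a derivation both of the associative product and of the bracket; $\operatorname{Der}_{\mathcal P}(A)$ is the Lie algebra (under commutator) of Poisson derivations. For $\lambda\in\operatorname{Der}_{\mathcal P}(A)$ the weight space is $A_\lambda=\{a\in A\mid \{b,a\}=\lambda(b)a \text{ for all } b\in A\}$, and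 $\Lambda(A)=\{\lambda\in\operatorname{Der}_{\mathcal P}(A)\mid A_\lambda\neq 0\}$ is the set of weights of $A$, a commutative additive submonoid of $\operatorname{Der}_{\mathcal P}(A)$. One has $A_\lambda A_\mu\subseteq A_{\lambda+\mu}$ for $\lambda,\mu\in\Lambda(A)$. The decomposition of $A^{\mathrm{sc}}$ in (ii) is indexed by the monoid $\Lambda(A)$.
   Formalization: The sum of the weight spaces need not be direct even under (i) (k[x,y], {y,x}=x(x+1): 1, x, x+1 have distinct weights), so the equivalence is proved with a plain sum in (ii), and with the direct sum when the weight spaces are independent. *)

theory Defs
  imports Complex_Main "HOL-Library.Function_Algebras"
begin

text \<open>Since \<^class>\<open>comm_ring_1\<close> has \<open>0 \<noteq> 1\<close>, an integral Poisson algebra is a Poisson algebra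
  whose underlying type has class \<^class>\<open>idom\<close>.\<close>

locale poisson_algebra = vector_space scale
  for scale :: "'k::field_char_0 \<Rightarrow> 'a::comm_ring_1 \<Rightarrow> 'a" +
  fixes bracket :: "'a \<Rightarrow> 'a \<Rightarrow> 'a"
  assumes scale_mult: "scale r (a * b) = scale r a * b"
    and bracket_linear_left: "Vector_Spaces.linear scale scale (\<lambda>a. bracket a b)"
    and bracket_linear_right: "Vector_Spaces.linear scale scale (\<lambda>b. bracket a b)"
    and bracket_self: "bracket a a = 0"
    and jacobi: "bracket a (bracket b c) + bracket b (bracket c a) + bracket c (bracket a b) = 0"
    and leibniz_left: "bracket (a * b) c = a * bracket b c + bracket a c * b"
    and leibniz_right: "bracket a (b * c) = b * bracket a c + bracket a b * c"
begin

definition poisson_normal :: "'a \<Rightarrow> bool" where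
  "poisson_normal a \<longleftrightarrow> range (\<lambda>b. bracket b a) \<subseteq> range (\<lambda>c. c * a)"

definition subalgebra :: "'a set \<Rightarrow> bool" where
  "subalgebra S \<longleftrightarrow> subspace S \<and> 1 \<in> S \<and> (\<forall>a\<in>S. \<forall>b\<in>S. a * b \<in> S)"

definition poisson_subalgebra :: "'a set \<Rightarrow> bool" where
  "poisson_subalgebra S \<longleftrightarrow> subalgebra S \<and> (\<forall>a\<in>S. \<forall>b\<in>S. bracket a b \<in> S)"

definition semicentre :: "'a set" where
  "semicentre = subalgebra hull {a. poisson_normal a}"

definition poisson_derivation :: "('a \<Rightarrow> 'a) \<Rightarrow> bool" where
  "poisson_derivation D \<longleftrightarrow> Vector_Spaces.linear scale scale D \<and>
     (\<forall>a b. D (a * b) = D a * b + a * D b) \<and>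
     (\<forall>a b. D (bracket a b) = bracket (D a) b + bracket a (D b))"

definition weight_space :: "('a \<Rightarrow> 'a) \<Rightarrow> 'a set" where
  "weight_space \<mu> = {a. \<forall>b. bracket b a = \<mu> b * a}"

definition weights :: "('a \<Rightarrow> 'a) set" where
  "weights = {\<mu>. poisson_derivation \<mu> \<and> weight_space \<mu> \<noteq> {0}}"

text \<open>\<open>W (\<mu> + \<nu>)\<close> uses the pointwise sum of maps from \<^theory>\<open>HOL-Library.Function_Algebras\<close>.\<close>

definition poisson_graded :: "('a \<Rightarrow> 'a) set \<Rightarrow> (('a \<Rightarrow> 'a) \<Rightarrow> 'a set) \<Rightarrow> bool" where
  "poisson_graded \<Lambda> W \<longleftrightarrow>
     (\<forall>\<mu>\<in>\<Lambda>. \<forall>\<nu>\<in>\<Lambda>. \<forall>a\<in>W \<mu>. \<forall>b\<in>W \<nu>. bracket a b \<in> W (\<mu> + \<nu>))"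

definition sum_decomposition :: "'a set \<Rightarrow> 'i set \<Rightarrow> ('i \<Rightarrow> 'a set) \<Rightarrow> bool" where
  "sum_decomposition S I V \<longleftrightarrow> (\<forall>i\<in>I. subspace (V i)) \<and> S = span (\<Union>i\<in>I. V i)"

text \<open>The sum of the weight spaces of an integral Poisson algebra need not be direct, even if all
  weights commute. On \<open>k[x,y]\<close> with \<open>{y,x} = x(x+1)\<close> the elements \<open>1\<close>, \<open>x\<close>, \<open>x+1\<close> have the
  pairwise distinct weights \<open>0\<close>, \<open>(x+1)\<partial>/\<partial>y\<close>, \<open>x\<partial>/\<partial>y\<close>, but \<open>1 + x = x+1\<close>; every weight
  has the form \<open>f(x) \<partial>/\<partial>y\<close>, so any two commute.\<close>

definition independent_family :: "'i set \<Rightarrow> ('i \<Rightarrow> 'a set) \<Rightarrow> bool" where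
  "independent_family I V \<longleftrightarrow>
     (\<forall>F v. finite F \<and> F \<subseteq> I \<and> (\<forall>i\<in>F. v i \<in> V i) \<and> sum v F = 0 \<longrightarrow> (\<forall>i\<in>F. v i = 0))"

definition direct_sum_decomposition :: "'a set \<Rightarrow> 'i set \<Rightarrow> ('i \<Rightarrow> 'a set) \<Rightarrow> bool" where
  "direct_sum_decomposition S I V \<longleftrightarrow> sum_decomposition S I V \<and> independent_family I V"

end

end

theory Submission
  imports Defs
begin

text \<open>For \<open>a \<in> A\<^sub>\<mu>\<close> and \<open>c \<in> A\<^sub>\<nu>\<close>, the Jacobi and Leibniz identities give
  \<open>{b,{a,c}} = (\<mu> + \<nu>)(b) {a,c} + (\<nu>(\<mu>(b)) - \<mu>(\<nu>(b))) a c\<close>, so that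
  \<open>{a,c} \<in> A\<^bsub>\<mu>+\<nu>\<^esub>\<close> if and only if \<open>[\<mu>,\<nu>](b) a c = 0\<close> for all \<open>b\<close>. Every weight has a nonzero
  weight vector, so in a domain the Poisson grading condition amounts to \<open>[\<mu>,\<nu>] = 0\<close>. That
  \<open>A\<^sup>s\<^sup>c\<close> is the sum of the weight spaces needs no commutativity: a nonzero normal element is a
  weight vector, and the weight spaces are closed under products.\<close>

context poisson_algebra
begin

section \<open>Bilinearity, antisymmetry and the Jacobi identity\<close>

lemma bracket_add_left: "bracket (a + b) c = bracket a c + bracket b c"
  using bracket_linear_left[of c] by (simp add: Vector_Spaces.linear_iff)

lemma bracket_add_right: "bracket a (b + c) = bracket a b + bracket a c"
  using bracket_linear_right[of a] by (simp add: Vector_Spaces.linear_iff)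

lemma bracket_scale_left: "bracket (scale r a) b = scale r (bracket a b)"
  using bracket_linear_left[of b] by (simp add: Vector_Spaces.linear_iff)

lemma bracket_scale_right: "bracket a (scale r b) = scale r (bracket a b)"
  using bracket_linear_right[of a] by (simp add: Vector_Spaces.linear_iff)

lemma bracket_zero_left: "bracket 0 a = 0"
  using bracket_add_left[of 0 0 a] by simp

lemma bracket_zero_right: "bracket a 0 = 0"
  using bracket_add_right[of a 0 0] by simp

lemma bracket_one_right: "bracket a 1 = 0"
  using leibniz_right[of a 1 1] by simp

lemma mult_scale: "a * scale r b = scale r (a * b)"
  using scale_mult[of r b a] by (simp add: mult.commute)

lemma bracket_antisym: "bracket a b = - bracket b a"
proof -
  have "bracket a b + bracket b a = 0"
    using bracket_self[of "a + b"]
    unfolding bracket_add_left bracket_add_right bracket_self[of a] bracket_self[of b]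
    by (simp add: add.commute)
  then show ?thesis
    by (rule eq_neg_iff_add_eq_0[THEN iffD2])
qed

lemma bracket_minus_right: "bracket a (- b) = - bracket a b"
  using bracket_add_right[of a b "- b"] bracket_zero_right[of a]
  by (metis add.right_inverse minus_unique)

text \<open>The Jacobi identity rewritten by antisymmetry: \<open>bracket a\<close> is a derivation
  of the bracket. The later weight computations use it in this form.\<close>

lemma bracket_bracket_right:
  "bracket a (bracket b c) = bracket (bracket a b) c + bracket b (bracket a c)"
proof -
  have "bracket (bracket a b) c = - bracket c (bracket a b)"
    "bracket b (bracket a c) = - bracket b (bracket c a)"
    using bracket_antisym bracket_minus_right by metis+
  moreover have "bracket a (bracket b c) = - (bracket b (bracket c a) + bracket c (bracket a b))"
    using jacobi[of a b c] by (simp only: eq_neg_iff_add_eq_0 add.assoc)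
  ultimately show ?thesis
    by (simp only: minus_add)
qed

section \<open>Poisson derivations and closure of spans\<close>

lemma poisson_derivationD:
  assumes "poisson_derivation D"
  shows "D (a + b) = D a + D b" "D (scale r a) = scale r (D a)"
    "D (a * b) = D a * b + a * D b" "D (bracket a b) = bracket (D a) b + bracket a (D b)"
  using assms by (simp_all add: poisson_derivation_def Vector_Spaces.linear_iff)

lemma poisson_derivation_zero: "poisson_derivation 0"
  by (simp add: poisson_derivation_def Vector_Spaces.linear_iff vector_space_axioms bracket_zero_left
      bracket_zero_right)

lemma poisson_derivation_add:
  assumes "poisson_derivation D" "poisson_derivation E"
  shows "poisson_derivation (D + E)"
  using poisson_derivationD[OF assms(1)] poisson_derivationD[OF assms(2)]
  by (simp add: poisson_derivation_def Vector_Spaces.linear_iff vector_space_axioms algebra_simps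
      scale_right_distrib bracket_add_left bracket_add_right)

text \<open>By bilinearity it suffices to multiply generators; the induction extends first the left
  factor, then the right one, to the whole span.\<close>

lemma subalgebra_span:
  assumes "1 \<in> span S" and "\<And>a b. a \<in> S \<Longrightarrow> b \<in> S \<Longrightarrow> a * b \<in> span S"
  shows "subalgebra (span S)"
proof -
  have *: "a * b \<in> span S" if "a \<in> span S" "b \<in> S" for a b
    using that by (induction rule: span_induct_alt)
      (auto simp: distrib_right scale_mult[symmetric] intro: span_zero span_add span_scale assms)
  have "a * b \<in> span S" if "b \<in> span S" "a \<in> span S" for a b
    using that by (induction rule: span_induct_alt)
      (auto simp: distrib_left mult_scale intro: span_zero span_add span_scale *)
  with assms(1) show ?thesis
    by (simp add: subalgebra_def)
qed

lemma bracket_in_span: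
  assumes "\<And>a b. a \<in> S \<Longrightarrow> b \<in> S \<Longrightarrow> bracket a b \<in> span S"
    and "a \<in> span S" "b \<in> span S"
  shows "bracket a b \<in> span S"
proof -
  have *: "bracket a b \<in> span S" if "a \<in> span S" "b \<in> S" for a b
    using that by (induction rule: span_induct_alt)
      (auto simp: bracket_zero_left bracket_add_left bracket_scale_left
        intro: span_zero span_add span_scale assms(1))
  show ?thesis
    using assms(3,2) by (induction rule: span_induct_alt)
      (auto simp: bracket_zero_right bracket_add_right bracket_scale_right
        intro: span_zero span_add span_scale *)
qed

section \<open>Semi-centre, weights and weight spaces\<close>

lemma subalgebra_semicentre: "subalgebra semicentre"
  unfolding semicentre_def
  by (rule hull_in) (auto simp: subalgebra_def intro: subspace_Inter)

lemma subspace_weight_space: "subspace (weight_space \<mu>)"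
  by (auto simp: subspace_def weight_space_def bracket_zero_right bracket_add_right
      bracket_scale_right distrib_left mult_scale)

text \<open>An empty set would also differ from \<open>{0}\<close>; since a weight space is a
  subspace, differing from \<open>{0}\<close> does mean having a nonzero vector.\<close>

lemma weights_iff:
  "\<mu> \<in> weights \<longleftrightarrow> poisson_derivation \<mu> \<and> (\<exists>a. a \<noteq> 0 \<and> a \<in> weight_space \<mu>)"
  using subspace_0[OF subspace_weight_space[of \<mu>]] by (auto simp: weights_def)

lemma one_in_weight_space_zero: "1 \<in> weight_space 0"
  by (simp add: weight_space_def bracket_one_right)

lemma zero_in_weights: "0 \<in> weights"
  unfolding weights_iff
  using poisson_derivation_zero one_in_weight_space_zero zero_neq_one by metis

lemma weight_space_mult:
  assumes "a \<in> weight_space \<mu>" "c \<in> weight_space \<nu>"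
  shows "a * c \<in> weight_space (\<mu> + \<nu>)"
  using assms by (simp add: weight_space_def leibniz_right algebra_simps)

lemma poisson_normal_weight_vector: "a \<in> weight_space \<mu> \<Longrightarrow> poisson_normal a"
  by (auto simp: poisson_normal_def weight_space_def)

lemma bracket_bracket_weight_vectors:
  assumes "a \<in> weight_space \<mu>" "c \<in> weight_space \<nu>"
  shows "bracket b (bracket a c) = (\<mu> + \<nu>) b * bracket a c + (\<nu> (\<mu> b) - \<mu> (\<nu> b)) * (a * c)"
proof -
  \<comment> \<open>Weights describe brackets with the weight vector on the right. In the last
    equation it stands on the left, and the resulting sign is what produces a commutator.\<close>
  have "bracket b a = \<mu> b * a" "bracket b c = \<nu> b * c" "bracket (\<mu> b) c = \<nu> (\<mu> b) * c"
    "bracket a (\<nu> b) = - (\<mu> (\<nu> b) * a)"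
    using assms bracket_antisym[of a "\<nu> b"] by (simp_all add: weight_space_def)
  then show ?thesis
    unfolding bracket_bracket_right[of b a c]
    by (simp add: leibniz_left leibniz_right algebra_simps)
qed

lemma poisson_graded_if_commute:
  assumes "\<forall>\<mu>\<in>weights. \<forall>\<nu>\<in>weights. (\<mu> \<circ> \<nu>) - (\<nu> \<circ> \<mu>) = 0"
  shows "poisson_graded weights weight_space"
  unfolding poisson_graded_def
proof (intro ballI)
  fix \<mu> \<nu> a c
  assume *: "\<mu> \<in> weights" "\<nu> \<in> weights" "a \<in> weight_space \<mu>" "c \<in> weight_space \<nu>"
  have "\<nu> (\<mu> b) - \<mu> (\<nu> b) = 0" for b
    using assms[rule_format, OF *(2,1)] by (simp add: fun_eq_iff)
  then show "bracket a c \<in> weight_space (\<mu> + \<nu>)"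
    using bracket_bracket_weight_vectors[OF *(3,4)] by (simp add: weight_space_def)
qed

text \<open>Apply \<open>D\<close> to \<open>bracket b c = \<nu> b * c\<close> and expand both
  sides: the terms \<open>\<nu> (D b) * c\<close> and \<open>D (\<nu> b) * c\<close> agree and
  cancel. For a weight \<open>D\<close> this is the final claim of the theorem.\<close>

lemma derivation_preserves_weight_space:
  assumes "poisson_derivation D" "(D \<circ> \<nu>) - (\<nu> \<circ> D) = 0"
  shows "D ` weight_space \<nu> \<subseteq> weight_space \<nu>"
proof (rule image_subsetI)
  fix c assume c: "c \<in> weight_space \<nu>"
  have "bracket b (D c) = \<nu> b * D c" for b
  proof -
    have "D (\<nu> b) = \<nu> (D b)"
      using fun_cong[OF assms(2), of b] by simp
    moreover have "D (bracket b c) = D (\<nu> b * c)" "bracket (D b) c = \<nu> (D b) * c"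
      using c by (simp_all add: weight_space_def)
    ultimately show ?thesis
      using poisson_derivationD(3,4)[OF assms(1)] by simp
  qed
  then show "D c \<in> weight_space \<nu>"
    by (simp add: weight_space_def)
qed

end

section \<open>Integral Poisson algebras: cancellation of nonzero elements\<close>

locale integral_poisson_algebra = poisson_algebra scale bracket
  for scale :: "'k::field_char_0 \<Rightarrow> 'a::idom \<Rightarrow> 'a" and bracket
begin

text \<open>The product of two nonzero weight vectors is nonzero in a domain and has the sum of
  their weights.\<close>

lemma weights_add:
  assumes "\<mu> \<in> weights" "\<nu> \<in> weights"
  shows "\<mu> + \<nu> \<in> weights"
proof -
  obtain a c where "a \<noteq> 0" "a \<in> weight_space \<mu>" "c \<noteq> 0" "c \<in> weight_space \<nu>"
    using assms by (auto simp: weights_iff)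
  then have "a * c \<noteq> 0" "a * c \<in> weight_space (\<mu> + \<nu>)"
    by (simp_all add: weight_space_mult)
  then show ?thesis
    using assms poisson_derivation_add unfolding weights_iff by blast
qed

text \<open>The weight sends \<open>b\<close> to the quotient of \<open>bracket b a\<close> by
  \<open>a\<close>, which is unique in a domain. Each law of a Poisson derivation is checked after
  multiplication by \<open>a\<close>.\<close>

lemma poisson_normal_obtains_weight:
  assumes "poisson_normal a" "a \<noteq> 0"
  obtains \<mu> where "\<mu> \<in> weights" "a \<in> weight_space \<mu>"
proof -
  have "\<forall>b. \<exists>c. bracket b a = c * a"
    using assms(1) by (auto simp: poisson_normal_def)
  then obtain \<mu> where \<mu>: "bracket b a = \<mu> b * a" for b
    by metis
  have cancel: "x = y" if "x * a = y * a" for x y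
    using that assms(2) by simp
  have "\<mu> (b + c) = \<mu> b + \<mu> c" for b c
    by (rule cancel) (simp add: \<mu>[symmetric] bracket_add_left distrib_right)
  moreover have "\<mu> (scale r b) = scale r (\<mu> b)" for r b
    by (rule cancel) (simp add: \<mu>[symmetric] bracket_scale_left scale_mult[symmetric])
  moreover have "\<mu> (b * c) = \<mu> b * c + b * \<mu> c" for b c
  proof (rule cancel)
    show "\<mu> (b * c) * a = (\<mu> b * c + b * \<mu> c) * a"
      using leibniz_left[of b c a] by (simp add: \<mu> algebra_simps)
  qed
  moreover have "\<mu> (bracket b c) = bracket (\<mu> b) c + bracket b (\<mu> c)" for b c
  proof (rule cancel)
    show "\<mu> (bracket b c) * a = (bracket (\<mu> b) c + bracket b (\<mu> c)) * a"
      \<comment> \<open>Expanding \<open>bracket b (\<mu> c * a)\<close> and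
        \<open>bracket c (\<mu> b * a)\<close> gives the same term
        \<open>\<mu> b * \<mu> c * a\<close> on both sides of the Jacobi identity, and it
        cancels.\<close>
      using bracket_bracket_right[of b c a] bracket_antisym[of c "\<mu> b"]
      by (simp add: \<mu> leibniz_right algebra_simps)
  qed
  ultimately have "poisson_derivation \<mu>"
    by (simp add: poisson_derivation_def Vector_Spaces.linear_iff vector_space_axioms)
  with \<mu> assms(2) have "\<mu> \<in> weights" "a \<in> weight_space \<mu>"
    by (auto simp: weights_iff weight_space_def)
  then show thesis
    by (rule that)
qed

lemma weight_vector_in_span:
  "\<mu> \<in> weights \<Longrightarrow> a \<in> weight_space \<mu> \<Longrightarrow> a \<in> span (\<Union>\<mu>\<in>weights. weight_space \<mu>)"
  by (rule span_base) (rule UN_I)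

lemma semicentre_eq_span: "semicentre = span (\<Union>\<mu>\<in>weights. weight_space \<mu>)"
proof
  have "subalgebra (span (\<Union>\<mu>\<in>weights. weight_space \<mu>))"
  proof (rule subalgebra_span)
    show "1 \<in> span (\<Union>\<mu>\<in>weights. weight_space \<mu>)"
      by (rule weight_vector_in_span[OF zero_in_weights one_in_weight_space_zero])
    show "a * b \<in> span (\<Union>\<mu>\<in>weights. weight_space \<mu>)"
      if "a \<in> (\<Union>\<mu>\<in>weights. weight_space \<mu>)" "b \<in> (\<Union>\<mu>\<in>weights. weight_space \<mu>)" for a b
      using that by (elim UN_E) (rule weight_vector_in_span[OF weights_add weight_space_mult])
  qed
  moreover have "{a. poisson_normal a} \<subseteq> span (\<Union>\<mu>\<in>weights. weight_space \<mu>)"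
  proof
    fix a assume "a \<in> {a. poisson_normal a}"
    then have "poisson_normal a"
      by simp
    then show "a \<in> span (\<Union>\<mu>\<in>weights. weight_space \<mu>)"
      \<comment> \<open>Zero is normal but determines no quotient, so it is treated apart.\<close>
      by (cases "a = 0")
        (blast intro: span_zero weight_vector_in_span elim: poisson_normal_obtains_weight)+
  qed
  ultimately show "semicentre \<subseteq> span (\<Union>\<mu>\<in>weights. weight_space \<mu>)"
    unfolding semicentre_def by (intro hull_minimal)
  have "{a. poisson_normal a} \<subseteq> semicentre"
    unfolding semicentre_def by (rule hull_subset)
  then show "span (\<Union>\<mu>\<in>weights. weight_space \<mu>) \<subseteq> semicentre"
    using subalgebra_semicentre poisson_normal_weight_vector
    by (intro span_minimal UN_least) (auto simp only: subalgebra_def)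
qed

lemma sum_decomposition_semicentre: "sum_decomposition semicentre weights weight_space"
  by (simp add: sum_decomposition_def subspace_weight_space semicentre_eq_span)

text \<open>The grading sends two weight vectors to a weight space whose index is again a weight;
  bilinearity extends this to their span, the semi-centre.\<close>

lemma poisson_subalgebra_semicentre:
  assumes "poisson_graded weights weight_space"
  shows "poisson_subalgebra semicentre"
proof -
  have "bracket a b \<in> span (\<Union>\<mu>\<in>weights. weight_space \<mu>)"
    if "a \<in> (\<Union>\<mu>\<in>weights. weight_space \<mu>)" "b \<in> (\<Union>\<mu>\<in>weights. weight_space \<mu>)" for a b
    using that assms
    by (elim UN_E) (auto simp: poisson_graded_def intro: weight_vector_in_span[OF weights_add])
  then have "bracket a b \<in> semicentre" if "a \<in> semicentre" "b \<in> semicentre" for a b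
    using that unfolding semicentre_eq_span by (rule bracket_in_span)
  then show ?thesis
    by (simp add: poisson_subalgebra_def subalgebra_semicentre)
qed

lemma commute_if_poisson_graded:
  assumes "poisson_graded weights weight_space" "\<mu> \<in> weights" "\<nu> \<in> weights"
  shows "(\<mu> \<circ> \<nu>) - (\<nu> \<circ> \<mu>) = 0"
proof
  fix b
  obtain a c where ac: "a \<noteq> 0" "a \<in> weight_space \<mu>" "c \<noteq> 0" "c \<in> weight_space \<nu>"
    using assms(2,3) by (auto simp: weights_iff)
  then have "bracket b (bracket a c) = (\<mu> + \<nu>) b * bracket a c"
    using assms by (auto simp: poisson_graded_def weight_space_def)
  \<comment> \<open>Comparing the two expressions for \<open>bracket b (bracket a c)\<close> shows
    that the commutator at \<open>b\<close> times \<open>a * c\<close> vanishes, and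
    \<open>a * c\<close> is nonzero.\<close>
  with ac have "\<nu> (\<mu> b) - \<mu> (\<nu> b) = 0"
    using bracket_bracket_weight_vectors[of a \<mu> c \<nu> b] by simp
  then show "((\<mu> \<circ> \<nu>) - (\<nu> \<circ> \<mu>)) b = 0 b"
    by simp
qed

end

theorem proposition2p6:
  fixes scale :: "'k::field_char_0 \<Rightarrow> 'a::idom \<Rightarrow> 'a"
    and bracket :: "'a \<Rightarrow> 'a \<Rightarrow> 'a"
    and A_sc :: "'a set"
    and \<Lambda> :: "('a \<Rightarrow> 'a) set"
    and W :: "('a \<Rightarrow> 'a) \<Rightarrow> 'a set"
  assumes "poisson_algebra scale bracket"
    and "A_sc = poisson_algebra.semicentre scale bracket"
    and "\<Lambda> = poisson_algebra.weights scale bracket"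
    and "W = poisson_algebra.weight_space bracket"
  shows
    "((\<forall>\<mu>\<in>\<Lambda>. \<forall>\<nu>\<in>\<Lambda>. (\<mu> \<circ> \<nu>) - (\<nu> \<circ> \<mu>) = 0) \<longleftrightarrow>
        poisson_algebra.poisson_subalgebra scale bracket A_sc \<and>
        poisson_algebra.sum_decomposition scale A_sc \<Lambda> W \<and>
        poisson_algebra.poisson_graded bracket \<Lambda> W)
     \<and>
     (poisson_algebra.independent_family \<Lambda> W \<longrightarrow>
       ((\<forall>\<mu>\<in>\<Lambda>. \<forall>\<nu>\<in>\<Lambda>. (\<mu> \<circ> \<nu>) - (\<nu> \<circ> \<mu>) = 0) \<longleftrightarrow>
        poisson_algebra.poisson_subalgebra scale bracket A_sc \<and>
        poisson_algebra.direct_sum_decomposition scale A_sc \<Lambda> W \<and>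
        poisson_algebra.poisson_graded bracket \<Lambda> W))
     \<and>
     ((\<forall>\<mu>\<in>\<Lambda>. \<forall>\<nu>\<in>\<Lambda>. (\<mu> \<circ> \<nu>) - (\<nu> \<circ> \<mu>) = 0) \<or>
        poisson_algebra.poisson_subalgebra scale bracket A_sc \<and>
        poisson_algebra.sum_decomposition scale A_sc \<Lambda> W \<and>
        poisson_algebra.poisson_graded bracket \<Lambda> W
      \<longrightarrow> (\<forall>\<mu>\<in>\<Lambda>. \<forall>\<nu>\<in>\<Lambda>. \<mu> ` W \<nu> \<subseteq> W \<nu>))"
proof -
  interpret integral_poisson_algebra scale bracket
    using assms(1) by (rule integral_poisson_algebra.intro)
  have graded_iff: "poisson_graded weights weight_space \<longleftrightarrow>
      (\<forall>\<mu>\<in>weights. \<forall>\<nu>\<in>weights. (\<mu> \<circ> \<nu>) - (\<nu> \<circ> \<mu>) = 0)"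
    using poisson_graded_if_commute commute_if_poisson_graded by blast
  moreover have "\<mu> ` weight_space \<nu> \<subseteq> weight_space \<nu>"
    if "poisson_graded weights weight_space" "\<mu> \<in> weights" "\<nu> \<in> weights" for \<mu> \<nu>
    using that commute_if_poisson_graded
    by (intro derivation_preserves_weight_space) (auto simp: weights_iff)
  \<comment> \<open>The sum decomposition always holds and the grading implies closure under the
    bracket, so (ii) reduces to the grading. The direct version adds only independence, which is
    assumed there.\<close>
  ultimately show ?thesis
    using poisson_subalgebra_semicentre sum_decomposition_semicentre
    unfolding assms(2-4) direct_sum_decomposition_def graded_iff[symmetric] by blast
qed

end
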